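(* Let $m$ be the number of alternatives and $n$ the number of preferences in the input profile. For every $0<\varepsilon_a'\le1$ and $0<\delta<1/2$ such that $\mathrm{con}_{\text{single peaked}}(\lceil(1-\varepsilon_a')m\rceil)<1$, any $(0,0,0,\varepsilon_a',\delta,\text{single peaked})$-Arbitrary Outliers vs Arbitrary Profile Tester has sample complexity $\Omega\left(n\log\frac1\delta\right)$.
   Context: Profiles. Let $\mathcal{A}$ be a finite set of $m$ alternatives and $\mathcal{L}(\mathcal{A})$ the set of linear orders (preferences) over $\mathcal{A}$; for $\mathcal{X}\subseteq\mathcal{A}$, $\succ(\mathcal{X})$ is the restriction of $\succ$ to $\mathcal{X}$. A profile is a tuple $(\succ_i)_{i\in[n]}$ of $n$ preferences over $\mathcal{A}$, one per agent. A profile is single peaked if there is a linear order (societal axis) on the alternatives such that, for every preference $\succ$ in the profile with most preferred alternative $t$, whenever $x$ lies between $t$ and $y$ on the axis (with $x\ne y$), we have $x\succ y$. The content $\mathrm{con}_{\text{single peaked}}$ is the function such that $\mathrm{con}_{\text{single peaked}}(k)\,k!$ is the maximum number of distinct preferences in a single peaked profile over $k$ alternatives (with the convention $\mathrm{con}_{\text{single peaked}}(0)=1$). Sampling model. An oracle, when queried, returns an agent picked uniformly at random with replacement from the set of all $n$ agents. The algorithm may then ask this agent arbitrarily many comparison queries: given two alternatives $x,y$, the agent replies which of the two it prefers. The sample complexity of an algorithm is the total number of comparison queries it makes. Problem. A $(0,0,0,\varepsilon_a',\delta,\text{single peaked})$-Arbitrary Outliers vs Arbitrary Profile Tester is a (randomized)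 algorithm in this model which, given a profile $(\succ_i)_{i\in[n]}$ over $\mathcal{A}$ that is of one of the following two kinds, outputs $1$ if it is of kind (i) and $0$ if it is of kind (ii), with error probability at most $\delta$: (i) $(\succ_i)_{i\in[n]}$ is single peaked; (ii) for every $\mathcal{X}\subseteq\mathcal{A}$ with $|\mathcal{X}|>(1-\varepsilon_a')m$, the profile $(\succ_i(\mathcal{X}))_{i\in[n]}$ is not single peaked. The error probability is over the randomness of the algorithm (including the oracle). *)

theory Defs
  imports "HOL-Probability.Probability"
begin

text \<open>A preference over A is a (reflexive) linear order on A in the sense of the library;
  \<open>(x, y) \<in> r\<close> reads ``x is at least as preferred as y''.  A profile lists one preference per agent,
  with repetitions allowed.\<close>

type_synonym 'a preference = "('a \<times> 'a) set"

definition is_profile :: "'a set \<Rightarrow> 'a preference list \<Rightarrow> bool" where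
  "is_profile A P \<longleftrightarrow> (\<forall>r\<in>set P. linear_order_on A r)"

definition prefers :: "'a preference \<Rightarrow> 'a \<Rightarrow> 'a \<Rightarrow> bool" where
  "prefers r x y \<longleftrightarrow> (x, y) \<in> r \<and> x \<noteq> y"

definition most_preferred :: "'a set \<Rightarrow> 'a preference \<Rightarrow> 'a \<Rightarrow> bool" where
  "most_preferred A r t \<longleftrightarrow> t \<in> A \<and> (\<forall>x\<in>A. x \<noteq> t \<longrightarrow> prefers r t x)"

definition lies_between :: "('a \<times> 'a) set \<Rightarrow> 'a \<Rightarrow> 'a \<Rightarrow> 'a \<Rightarrow> bool" where
  "lies_between ax t x y \<longleftrightarrow> (t, x) \<in> ax \<and> (x, y) \<in> ax \<or> (y, x) \<in> ax \<and> (x, t) \<in> ax"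

definition single_peaked :: "'a set \<Rightarrow> 'a preference list \<Rightarrow> bool" where
  "single_peaked A P \<longleftrightarrow>
     (\<exists>ax. linear_order_on A ax \<and>
        (\<forall>r\<in>set P. \<forall>t. most_preferred A r t \<longrightarrow>
           (\<forall>x\<in>A. \<forall>y\<in>A. x \<noteq> y \<and> lies_between ax t x y \<longrightarrow> prefers r x y)))"

definition restrict_profile :: "'a preference list \<Rightarrow> 'a set \<Rightarrow> 'a preference list" where
  "restrict_profile P X = map (\<lambda>r. Restr r X) P"

text \<open>The k alternatives are taken to be the numbers below k; the maximum ranges over profiles with
  any number of agents, and \<open>card (set P)\<close> counts distinct preferences.\<close>

definition con_single_peaked :: "nat \<Rightarrow> real" where
  "con_single_peaked k =
     (if k = 0 then 1
      else real (Max {card (set P) |P. is_profile {..<k} P \<and> single_peaked {..<k} P}) / fact k)"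

text \<open>Randomized algorithms.  \<open>Toss p\<close> uses internal randomness, \<open>Draw\<close> queries the oracle
  for a fresh random agent, and \<open>Ask j x y k\<close> asks the j-th agent drawn so far (counting from 0)
  to compare x and y and continues with k applied to the reply (True iff x is preferred).
  Agents drawn earlier may be asked again, and queries may be interleaved arbitrarily.
  Agents are anonymous: the algorithm learns about them only through the replies.\<close>

datatype 'a algorithm =
    Output bool
  | Toss "'a algorithm pmf"
  | Draw "'a algorithm"
  | Ask nat 'a 'a "bool \<Rightarrow> 'a algorithm"

text \<open>\<open>run T P ds\<close> is the joint distribution of the output of T and the number of comparison
  queries made by T on the profile P, where ds lists the preferences of the agents drawn so far.
  A query to an agent not yet drawn is answered by False (and is counted), so it is useless.\<close>

primrec run :: "'a algorithm \<Rightarrow> 'a preference list \<Rightarrow> 'a preference list \<Rightarrow> (bool \<times> nat) pmf" where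
  "run (Output b) P ds = return_pmf (b, 0)"
| "run (Toss p) P ds = bind_pmf (map_pmf run p) (\<lambda>f. f P ds)"
| "run (Draw T) P ds = bind_pmf (pmf_of_set {..<length P}) (\<lambda>i. run T P (ds @ [P ! i]))"
| "run (Ask j x y k) P ds =
     map_pmf (map_prod id Suc) (run (k (j < length ds \<and> prefers (ds ! j) x y)) P ds)"

text \<open>The two kinds of inputs; \<open>\<epsilon>\<close> is the fraction of alternatives that may be outliers.\<close>

definition single_peaked_input :: "'a set \<Rightarrow> nat \<Rightarrow> 'a preference list \<Rightarrow> bool" where
  "single_peaked_input A n P \<longleftrightarrow> is_profile A P \<and> length P = n \<and> single_peaked A P"

definition far_input :: "'a set \<Rightarrow> nat \<Rightarrow> real \<Rightarrow> 'a preference list \<Rightarrow> bool" where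
  "far_input A n \<epsilon> P \<longleftrightarrow> is_profile A P \<and> length P = n \<and>
     (\<forall>X\<subseteq>A. real (card X) > (1 - \<epsilon>) * real (card A) \<longrightarrow>
        \<not> single_peaked X (restrict_profile P X))"

definition is_tester :: "'a set \<Rightarrow> nat \<Rightarrow> real \<Rightarrow> real \<Rightarrow> 'a algorithm \<Rightarrow> bool" where
  "is_tester A n \<epsilon> \<delta> T \<longleftrightarrow>
     (\<forall>P. single_peaked_input A n P \<longrightarrow>
        measure_pmf.prob (run T P []) {(b, q). b \<noteq> True} \<le> \<delta>) \<and>
     (\<forall>P. far_input A n \<epsilon> P \<longrightarrow>
        measure_pmf.prob (run T P []) {(b, q). b \<noteq> False} \<le> \<delta>)"

text \<open>Worst case, over the admissible inputs and over all runs of positive probability, of the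
  total number of comparison queries; it is \<open>\<infinity>\<close> if that number is unbounded.\<close>

definition sample_complexity :: "'a set \<Rightarrow> nat \<Rightarrow> real \<Rightarrow> 'a algorithm \<Rightarrow> ereal" where
  "sample_complexity A n \<epsilon> T =
     (SUP P \<in> {P. single_peaked_input A n P \<or> far_input A n \<epsilon> P}.
        SUP (b, q) \<in> set_pmf (run T P []). ereal (real q))"

text \<open>Convention for \<open>\<Omega>(n log (1/\<delta>))\<close>: the lower bound holds for all sufficiently large n (depending
  on the number of alternatives), with a constant that is uniform over \<open>0 < \<delta> \<le> \<delta>\<^sub>0\<close> for each
  \<open>\<delta>\<^sub>0 < 1/2\<close>.  A constant uniform over all \<open>\<delta> < 1/2\<close> does not exist: as \<open>\<delta>\<close> tends to 1/2, testers
  that are only slightly better than guessing suffice.\<close>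

end

theory Submission
  imports Defs
begin

text \<open>Number the alternatives \<open>0, \<dots>, m - 1\<close>.  If all agents rank them in increasing order, the
  profile is single peaked.  Now let agent m rank them in decreasing order and, for every \<open>i < m\<close>, let
  agent i move the alternative i to the top.  Then among \<open>u < v < w\<close> the last alternative is u for
  agent m, v for agent w, and w for agent u, so no three alternatives are single peaked, whereas
  \<open>con k < 1\<close> forces \<open>k \<ge> 3\<close>; hence the new profile is far.  But a comparison of x and y
  exposes only the agents x, y and m, so a query hits a changed agent with probability \<open>O(1/n)\<close>
  with a constant independent of m.  Thus q queries leave the two profiles indistinguishable with
  probability at least \<open>exp (- 12 * q / n)\<close>, and the tester errs at least that often, up to the factor
  \<open>1 - \<delta>\<close>.\<close>

subsection \<open>Indistinguishable profiles\<close>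

lemma in_listset_iff:
  "xs \<in> listset As \<longleftrightarrow> length xs = length As \<and> (\<forall>j<length As. xs ! j \<in> As ! j)"
proof (induction As arbitrary: xs)
  case (Cons A As)
  then show ?case
    by (cases xs) (auto simp: set_Cons_def All_less_Suc2)
qed auto

lemma finite_listset: "(\<And>A. A \<in> set As \<Longrightarrow> finite A) \<Longrightarrow> finite (listset As)"
proof (induction As)
  case (Cons A As)
  have "set_Cons A (listset As) = (\<lambda>(x, xs). x # xs) ` (A \<times> listset As)"
    by (auto simp: set_Cons_def)
  with Cons show ?case by simp
qed simp

text \<open>Drawing an agent appends one coordinate, so this unfolds the sum over identities in the
  \<open>Draw\<close> case.\<close>

lemma sum_listset_snoc:
  fixes f :: "'a list \<Rightarrow> 'b :: comm_monoid_add"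
  shows "(\<Sum>xs\<in>listset (As @ [B]). f xs) = (\<Sum>xs\<in>listset As. \<Sum>x\<in>B. f (xs @ [x]))"
proof -
  have "bij_betw (\<lambda>(xs, x). xs @ [x]) (listset As \<times> B) (listset (As @ [B]))"
  proof (rule bij_betwI[where g = "\<lambda>xs. (butlast xs, last xs)"])
    show "(\<lambda>(xs, x). xs @ [x]) \<in> listset As \<times> B \<rightarrow> listset (As @ [B])"
      by (auto simp: in_listset_iff nth_append less_Suc_eq)
    show "(\<lambda>xs. (butlast xs, last xs)) \<in> listset (As @ [B]) \<rightarrow> listset As \<times> B"
    proof
      fix xs assume "xs \<in> listset (As @ [B])"
      then have len: "length xs = Suc (length As)"
        and el: "\<And>j. j < Suc (length As) \<Longrightarrow> xs ! j \<in> (As @ [B]) ! j"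
        by (auto simp: in_listset_iff)
      then have "xs \<noteq> []" by auto
      then have "last xs \<in> B"
        using el[of "length As"] len by (simp add: last_conv_nth)
      moreover have "butlast xs \<in> listset As"
        using el len by (auto simp: in_listset_iff nth_butlast nth_append)
          (metis less_SucI)
      ultimately show "(butlast xs, last xs) \<in> listset As \<times> B" by simp
    qed
  qed (auto simp: in_listset_iff intro!: append_butlast_last_id)
  then have "(\<Sum>xs\<in>listset (As @ [B]). f xs) = (\<Sum>(xs, x)\<in>listset As \<times> B. f (xs @ [x]))"
    by (subst sum.reindex_bij_betw[symmetric]) (auto simp: case_prod_unfold)
  then show ?thesis
    by (simp add: sum.cartesian_product)
qed

lemma card_listset: "card (listset As) = prod_list (map card As)"
proof (induction As)
  case (Cons A As)
  have "set_Cons A (listset As) = (\<lambda>(x, xs). x # xs) ` (A \<times> listset As)"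
    by (auto simp: set_Cons_def)
  moreover have "inj_on (\<lambda>(x, xs). x # xs) (A \<times> listset As)"
    by (auto simp: inj_on_def)
  ultimately show ?case
    using Cons by (simp add: card_image card_cartesian_product)
qed simp

section \<open>Acceptance probabilities and their loss per query\<close>

definition accept_prob :: "'a algorithm \<Rightarrow> 'a preference list \<Rightarrow> 'a preference list \<Rightarrow> real" where
  "accept_prob T P ds = measure_pmf.prob (run T P ds) {(b, q). b}"

lemma accept_prob_nonneg: "0 \<le> accept_prob T P ds"
  by (simp add: accept_prob_def)

lemma accept_prob_le_1: "accept_prob T P ds \<le> 1"
  by (simp add: accept_prob_def)

lemma prob_bind_pmf:
  "measure_pmf.prob (bind_pmf p f) X = measure_pmf.expectation p (\<lambda>x. measure_pmf.prob (f x) X)"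
proof -
  have "ennreal (measure_pmf.prob (bind_pmf p f) X) = (\<integral>\<^sup>+x. measure_pmf.prob (f x) X \<partial>p)"
    by (simp add: measure_pmf.emeasure_eq_measure[symmetric])
  also have "\<dots> = ennreal (measure_pmf.expectation p (\<lambda>x. measure_pmf.prob (f x) X))"
    by (intro nn_integral_eq_integral measure_pmf.integrable_const_bound[where B = 1]) auto
  finally show ?thesis
    by simp
qed

lemma accept_prob_Toss:
  "accept_prob (Toss p) P ds = measure_pmf.expectation p (\<lambda>T. accept_prob T P ds)"
  by (simp add: accept_prob_def prob_bind_pmf)

lemma accept_prob_Draw:
  assumes "P \<noteq> []"
  shows "accept_prob (Draw T) P ds
    = (\<Sum>i<length P. accept_prob T P (ds @ [P ! i])) / real (length P)"
  using assms by (simp add: accept_prob_def prob_bind_pmf integral_pmf_of_set lessThan_empty_iff)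

lemma accept_prob_Ask:
  "accept_prob (Ask j x y k) P ds
    = accept_prob (k (j < length ds \<and> prefers (ds ! j) x y)) P ds"
  by (simp add: accept_prob_def vimage_def case_prod_unfold)

text \<open>The constant 2 works because (1 - x)(1 + 2x) = 1 + x(1 - 2x) is at least 1 on [0, 1/2],
  and 1 + 2x is at most exp (2x). The loss per query thus becomes an exponential factor.\<close>

lemma exp_le_one_minus:
  fixes x :: real
  assumes "0 \<le> x" "x \<le> 1/2"
  shows "exp (- 2 * x) \<le> 1 - x"
proof -
  have "1 \<le> (1 - x) * (1 + 2 * x)"
    using mult_nonneg_nonneg[of x "1 - 2 * x"] assms by (simp add: algebra_simps)
  also have "\<dots> \<le> (1 - x) * exp (2 * x)"
    using assms by (intro mult_left_mono) auto
  finally have "exp (- 2 * x) * 1 \<le> exp (- 2 * x) * ((1 - x) * exp (2 * x))"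
    by (intro mult_left_mono) auto
  then show ?thesis
    by (simp add: exp_minus field_simps)
qed

text \<open>A sum over \<open>listset Ss\<close> averages over the identities of the drawn agents, where \<open>Ss ! j\<close>
  is the set of identities for which agent j has so far given the same replies as r.  It
  always contains the agents with preference r, so a query shrinks it by a factor of at most
  \<open>1 - 2 * b / n\<close>.\<close>
lemma sum_accept_prob_ge:
  fixes P :: "'a preference list" and r :: "'a preference" and b :: nat
  defines "n \<equiv> length P"
  assumes "P \<noteq> []"
    and b: "\<And>x y. card {i. i < n \<and> prefers (P ! i) x y \<noteq> prefers r x y} \<le> b" "4 * b \<le> n"
    and outliers: "2 * card {i. i < n \<and> P ! i \<noteq> r} \<le> n"
    and Ss: "\<And>S. S \<in> set Ss \<Longrightarrow> S \<subseteq> {..<n} \<and> {i. i < n \<and> P ! i = r} \<subseteq> S"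
    and Q: "\<And>a q. (a, q) \<in> set_pmf (run T (replicate n r) (replicate (length Ss) r)) \<Longrightarrow> real q \<le> Q"
  shows "accept_prob T (replicate n r) (replicate (length Ss) r)
           * real (prod_list (map card Ss)) * exp (- (4 * real b / real n) * Q)
         \<le> (\<Sum>is\<in>listset Ss. accept_prob T P (map ((!) P) is))"
  using Ss Q
proof (induction T arbitrary: Ss Q)
  case (Output c)
  have "real (prod_list (map card Ss)) = real (card (listset Ss))"
    by (simp add: card_listset)
  \<comment> \<open>\<open>Output c\<close> makes 0 queries, which forces
    \<open>0 \<le> Q\<close>.\<close>
  moreover have "exp (- (4 * real b / real n) * Q) \<le> 1"
    using Output.prems(2)[of c 0] by simp
  ultimately show ?case
    by (cases c) (auto simp: accept_prob_def mult_left_le)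
next
  case (Toss p)
  let ?P0 = "replicate n r" and ?ds = "replicate (length Ss) r"
  let ?K = "real (prod_list (map card Ss)) * exp (- (4 * real b / real n) * Q)"
  have int: "integrable (measure_pmf p) (\<lambda>T. accept_prob T P' ds)" for P' ds
    by (intro measure_pmf.integrable_const_bound[where B = 1])
      (auto simp: accept_prob_nonneg accept_prob_le_1)
  have "accept_prob (Toss p) ?P0 ?ds * real (prod_list (map card Ss))
          * exp (- (4 * real b / real n) * Q)
        = measure_pmf.expectation p (\<lambda>T. accept_prob T ?P0 ?ds * ?K)"
    by (simp add: accept_prob_Toss)
  also have "\<dots> \<le> measure_pmf.expectation p
                      (\<lambda>T. \<Sum>is\<in>listset Ss. accept_prob T P (map ((!) P) is))"
  proof (rule integral_mono_AE)
    show "AE T in measure_pmf p. accept_prob T ?P0 ?ds * ?K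
            \<le> (\<Sum>is\<in>listset Ss. accept_prob T P (map ((!) P) is))"
    proof (rule AE_pmfI)
      fix T assume T: "T \<in> set_pmf p"
      \<comment> \<open>\<open>Q\<close> bounds every run, so each outcome of the toss inherits
        it.\<close>
      have "real q \<le> Q" if "(a, q) \<in> set_pmf (run T ?P0 ?ds)" for a q
        using that T by (intro Toss.prems(2)[of a]) auto
      then have "accept_prob T ?P0 ?ds * real (prod_list (map card Ss))
              * exp (- (4 * real b / real n) * Q)
            \<le> (\<Sum>is\<in>listset Ss. accept_prob T P (map ((!) P) is))"
        using Toss.IH[OF T] Toss.prems(1) by blast
      then show "accept_prob T ?P0 ?ds * ?K
            \<le> (\<Sum>is\<in>listset Ss. accept_prob T P (map ((!) P) is))"
        by (simp only: mult.assoc)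
    qed
  qed (auto intro!: int Bochner_Integration.integrable_sum)
  also have "\<dots> = (\<Sum>is\<in>listset Ss. accept_prob (Toss p) P (map ((!) P) is))"
    by (simp add: accept_prob_Toss int)
  finally show ?case .
next
  case (Draw T)
  have "n > 0"
    using \<open>P \<noteq> []\<close> by (simp add: n_def)
  \<comment> \<open>Nothing is known yet about the new agent, so its set of identities is all of
    \<open>{..<n}\<close>; the extra factor \<open>n\<close> cancels against the uniform
    draw.\<close>
  have "accept_prob T (replicate n r) (replicate (length (Ss @ [{..<n}])) r)
           * real (prod_list (map card (Ss @ [{..<n}]))) * exp (- (4 * real b / real n) * Q)
         \<le> (\<Sum>is\<in>listset (Ss @ [{..<n}]). accept_prob T P (map ((!) P) is))"
  proof (rule Draw.IH)
    show "S \<subseteq> {..<n} \<and> {i. i < n \<and> P ! i = r} \<subseteq> S" if "S \<in> set (Ss @ [{..<n}])" for S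
      using that Draw.prems(1) by auto
    show "real q \<le> Q"
      if "(a, q) \<in> set_pmf (run T (replicate n r) (replicate (length (Ss @ [{..<n}])) r))" for a q
      using that \<open>n > 0\<close>
      by (intro Draw.prems(2)[of a])
        (auto simp: set_pmf_of_set lessThan_empty_iff replicate_append_same intro!: bexI[of _ 0])
  qed
  then show ?case
    using \<open>n > 0\<close> \<open>P \<noteq> []\<close>
    by (simp add: accept_prob_Draw replicate_append_same sum_listset_snoc n_def[symmetric]
        sum_divide_distrib[symmetric] field_simps)
next
  case (Ask j x y k)
  have "n > 0"
    using \<open>P \<noteq> []\<close> by (simp add: n_def)
  define c where "c = 4 * real b / real n"
  have "c \<ge> 0" by (simp add: c_def)
  define v where "v = (j < length Ss \<and> prefers r x y)"
  have v: "(j < length (replicate (length Ss) r) \<and> prefers (replicate (length Ss) r ! j) x y) = v"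
    by (auto simp: v_def)
  \<comment> \<open>The query asked here is counted, so the continuation has budget
    \<open>Q - 1\<close>.\<close>
  have q: "real q \<le> Q - 1"
    if "(a, q) \<in> set_pmf (run (k v) (replicate n r) (replicate (length Ss) r))" for a q
  proof -
    have "(a, Suc q) \<in> set_pmf (run (Ask j x y k) (replicate n r) (replicate (length Ss) r))"
      using that by (force simp only: run.simps v set_map_pmf map_prod_simp id_apply)
    from Ask.prems(2)[OF this] show ?thesis by simp
  qed
  have acc: "accept_prob (Ask j x y k) (replicate n r) (replicate (length Ss) r)
      = accept_prob (k v) (replicate n r) (replicate (length Ss) r)" (is "_ = ?a")
    by (simp only: accept_prob_Ask v)
  show ?case
  proof (cases "j < length Ss")
    case False
    then have "v = False"
      by (simp add: v_def)
    \<comment> \<open>An undrawn agent answers \<open>False\<close> on both profiles, so no set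
      shrinks and the factor \<open>exp (- c)\<close> allowed for this query is given away.\<close>
    have "?a * real (prod_list (map card Ss)) * exp (- c * Q)
        \<le> ?a * real (prod_list (map card Ss)) * exp (- c * (Q - 1))"
      using \<open>c \<ge> 0\<close> by (intro mult_left_mono) (auto simp: accept_prob_nonneg algebra_simps)
    also have "\<dots> \<le> (\<Sum>is\<in>listset Ss. accept_prob (k v) P (map ((!) P) is))"
      unfolding c_def using q by (intro Ask.IH[OF rangeI] Ask.prems(1))
    also have "\<dots> = (\<Sum>is\<in>listset Ss. accept_prob (Ask j x y k) P (map ((!) P) is))"
      using False by (intro sum.cong) (auto simp: accept_prob_Ask in_listset_iff \<open>v = False\<close>)
    finally show ?thesis
      by (simp only: acc c_def)
  next
    case True
    define S where "S = Ss ! j"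
    \<comment> \<open>Identities whose reply would reveal the difference. Agents with preference
      \<open>r\<close> are never among them, so the invariant on the sets survives their
      removal.\<close>
    define D where "D = {i. i < n \<and> prefers (P ! i) x y \<noteq> prefers r x y}"
    define Ss' where "Ss' = Ss[j := S - D]"
    have S: "S \<subseteq> {..<n}" "{i. i < n \<and> P ! i = r} \<subseteq> S"
      using Ask.prems(1)[of S] True by (auto simp: S_def)
    have Ss': "S' \<subseteq> {..<n} \<and> {i. i < n \<and> P ! i = r} \<subseteq> S'" if "S' \<in> set Ss'" for S'
    proof -
      have "S' \<in> insert (S - D) (set Ss)"
        using that set_update_subset_insert unfolding Ss'_def by fastforce
      then show ?thesis
        using Ask.prems(1)[of S'] S by (auto simp: D_def)
    qed
    have card: "real (card S) * exp (- c) \<le> real (card (S - D))"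
    proof -
      have "finite S"
        using S(1) finite_subset by blast
      \<comment> \<open>\<open>S\<close> contains all agents with preference \<open>r\<close>, hence
        at least half of all agents, so removing at most \<open>b\<close> of them is a relative loss
        of at most \<open>2 * b / n\<close>.\<close>
      have "{..<n} \<subseteq> {i. i < n \<and> P ! i \<noteq> r} \<union> S"
        using S(2) by auto
      then have "n \<le> card ({i. i < n \<and> P ! i \<noteq> r} \<union> S)"
        using card_mono[of "{i. i < n \<and> P ! i \<noteq> r} \<union> S" "{..<n}"] \<open>finite S\<close> by simp
      also have "\<dots> \<le> card {i. i < n \<and> P ! i \<noteq> r} + card S"
        by (rule card_Un_le)
      finally have "n \<le> 2 * card S"
        using outliers by simp
      \<comment> \<open>\<open>4 * b \<le> n\<close> keeps \<open>2 * b / n\<close> in the range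
        [0, 1/2] of \<open>exp_le_one_minus\<close>.\<close>
      have "exp (- c) \<le> 1 - 2 * real b / real n"
        using exp_le_one_minus[of "2 * real b / real n"] b(2) \<open>n > 0\<close>
        by (simp add: c_def field_simps)
      then have "real (card S) * exp (- c) \<le> real (card S) * (1 - 2 * real b / real n)"
        by (intro mult_left_mono) auto
      also have "\<dots> = real (card S) - real b * (2 * real (card S)) / real n"
        using \<open>n > 0\<close> by (simp add: field_simps)
      also have "\<dots> \<le> real (card S) - real b"
        using \<open>n \<le> 2 * card S\<close> \<open>n > 0\<close> mult_left_mono[of "real n" "2 * real (card S)" "real b"]
        by (simp add: field_simps)
      also have "\<dots> \<le> real (card S) - real (card D)"
        using b(1)[of x y] by (simp add: D_def)
      also have "\<dots> \<le> real (card (S - D))"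
        using diff_card_le_card_Diff[of D S] by (simp add: D_def)
      finally show ?thesis .
    qed
    have prod: "real (prod_list (map card Ss)) * exp (- c) \<le> real (prod_list (map card Ss'))"
    proof -
      have "prod_list (map card Ss)
          = card S * (prod_list (map card (take j Ss)) * prod_list (map card (drop (Suc j) Ss)))"
        using True by (subst id_take_nth_drop[of j Ss]) (auto simp: S_def)
      moreover have "prod_list (map card Ss')
          = card (S - D) * (prod_list (map card (take j Ss)) * prod_list (map card (drop (Suc j) Ss)))"
        using True by (simp add: Ss'_def upd_conv_take_nth_drop)
      ultimately show ?thesis
        using mult_right_mono[OF card, of "real (prod_list (map card (take j Ss)) *
          prod_list (map card (drop (Suc j) Ss)))"]
        by (simp add: mult_ac)
    qed
    \<comment> \<open>One factor \<open>exp (- c)\<close> pays for shrinking \<open>S\<close> to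
      \<open>S - D\<close>; the rest is the budget of the continuation.\<close>
    have "?a * real (prod_list (map card Ss)) * exp (- c * Q)
        = ?a * (real (prod_list (map card Ss)) * exp (- c)) * exp (- c * (Q - 1))"
      by (simp add: algebra_simps exp_diff exp_minus field_simps)
    also have "\<dots> \<le> ?a * real (prod_list (map card Ss')) * exp (- c * (Q - 1))"
      using prod by (intro mult_left_mono mult_right_mono) (auto simp: accept_prob_nonneg)
    also have "\<dots> \<le> (\<Sum>is\<in>listset Ss'. accept_prob (k v) P (map ((!) P) is))"
    proof -
      have len: "length Ss' = length Ss"
        by (simp add: Ss'_def)
      show ?thesis
        unfolding c_def len[symmetric] using q by (intro Ask.IH[OF rangeI] Ss') (simp_all only: len)
    qed
    also have "\<dots> = (\<Sum>is\<in>listset Ss'. accept_prob (Ask j x y k) P (map ((!) P) is))"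
    proof (intro sum.cong refl)
      fix "is" assume "is \<in> listset Ss'"
      then have len: "length is = length Ss" and "is ! j \<in> S - D"
        using True by (auto simp: in_listset_iff Ss'_def)
      then have "prefers (P ! (is ! j)) x y = prefers r x y"
        using S(1) by (auto simp: D_def)
      then show "accept_prob (k v) P (map ((!) P) is)
          = accept_prob (Ask j x y k) P (map ((!) P) is)"
        using True len by (simp add: accept_prob_Ask v_def)
    qed
    \<comment> \<open>Identities in \<open>D\<close> may lead to another branch; only the
      nonnegativity of their contribution is used.\<close>
    also have "\<dots> \<le> (\<Sum>is\<in>listset Ss. accept_prob (Ask j x y k) P (map ((!) P) is))"
    proof (rule sum_mono2)
      show "finite (listset Ss)"
        using Ask.prems(1) finite_subset by (intro finite_listset) blast
      show "listset Ss' \<subseteq> listset Ss"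
        using True by (force simp: in_listset_iff Ss'_def S_def nth_list_update split: if_splits)
    qed (rule accept_prob_nonneg)
    finally show ?thesis
      by (simp only: acc c_def)
  qed
qed

lemma tester_error_ge:
  fixes P :: "'a preference list" and r :: "'a preference" and b :: nat
  defines "n \<equiv> length P"
  assumes "P \<noteq> []"
    and "\<And>x y. card {i. i < n \<and> prefers (P ! i) x y \<noteq> prefers r x y} \<le> b" "4 * b \<le> n"
    and "2 * card {i. i < n \<and> P ! i \<noteq> r} \<le> n"
    and Q: "\<And>a q. (a, q) \<in> set_pmf (run T (replicate n r) []) \<Longrightarrow> real q \<le> Q"
    and yes: "measure_pmf.prob (run T (replicate n r) []) {(b, q). b \<noteq> True} \<le> \<delta>"
    and no: "measure_pmf.prob (run T P []) {(b, q). b \<noteq> False} \<le> \<delta>"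
  shows "(1 - \<delta>) * exp (- (4 * real b / real n) * Q) \<le> \<delta>"
proof -
  have "{(b, q). b \<noteq> True} = space (measure_pmf (run T (replicate n r) [])) - {(b, q :: nat). b}"
    by auto
  then have "1 - \<delta> \<le> accept_prob T (replicate n r) []"
    using yes by (simp only: accept_prob_def) (subst (asm) measure_pmf.prob_compl, auto)
  then have "(1 - \<delta>) * exp (- (4 * real b / real n) * Q)
      \<le> accept_prob T (replicate n r) [] * exp (- (4 * real b / real n) * Q)"
    by (intro mult_right_mono) auto
  \<comment> \<open>Before any draw the product of cardinalities is empty, hence 1, and the sum has
    a single term.\<close>
  also have "\<dots> \<le> accept_prob T P []"
    using sum_accept_prob_ge[of P r b "[]" T Q] assms by (simp add: n_def)
  also have "\<dots> \<le> \<delta>"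
    using no by (simp add: accept_prob_def)
  finally show ?thesis .
qed

subsection \<open>Rank orders\<close>

text \<open>Smaller rank means more preferred. Integer ranks allow reversal by negation and a value
  -1 below all natural numbers.\<close>

definition rank_order :: "'a set \<Rightarrow> ('a \<Rightarrow> int) \<Rightarrow> 'a preference" where
  "rank_order X g = {(x, y). x \<in> X \<and> y \<in> X \<and> g x \<le> g y}"

lemma linear_order_rank_order: "inj_on g X \<Longrightarrow> linear_order_on X (rank_order X g)"
  unfolding linear_order_on_def partial_order_on_def preorder_on_def rank_order_def
  by (auto simp: refl_on_def trans_def antisym_def total_on_def dest: inj_onD)

lemma Restr_rank_order: "X \<subseteq> A \<Longrightarrow> Restr (rank_order A g) X = rank_order X g"
  by (auto simp: rank_order_def)

lemma prefers_rank_order: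
  "prefers (rank_order X g) x y \<longleftrightarrow> x \<in> X \<and> y \<in> X \<and> x \<noteq> y \<and> g x \<le> g y"
  by (auto simp: rank_order_def prefers_def)

lemma rank_order_cong:
  "(\<And>x. x \<in> X \<Longrightarrow> g x = h x) \<Longrightarrow> rank_order X g = rank_order X h"
  by (auto simp: rank_order_def)

lemma ex_most_preferred_rank_order:
  assumes "finite X" "X \<noteq> {}"
  shows "\<exists>t. most_preferred X (rank_order X g) t"
proof -
  obtain t where "t \<in> X" "\<And>x. x \<in> X \<Longrightarrow> g t \<le> g x"
    using finite_imageI[OF assms(1), of g] assms(2) Min_in[of "g ` X"] Min_le[of "g ` X"]
    by (metis (no_types, lifting) image_iff image_is_empty)
  then show ?thesis
    by (auto simp: most_preferred_def prefers_rank_order)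
qed

text \<open>The common preference serves as the axis: the peak is an end of it, so moving away from
  the peak means moving down the preference.\<close>

lemma single_peaked_replicate:
  assumes "linear_order_on A r"
  shows "single_peaked A (replicate n r)"
  unfolding single_peaked_def
proof (intro exI conjI ballI allI impI)
  fix s t x y
  assume "s \<in> set (replicate n r)" "most_preferred A s t" "x \<in> A" "y \<in> A"
    and xy: "x \<noteq> y \<and> lies_between r t x y"
  then have "most_preferred A r t" and s: "s = r" by auto
  then have "y \<noteq> t \<Longrightarrow> (t, y) \<in> r"
    using \<open>y \<in> A\<close> by (auto simp: most_preferred_def prefers_def)
  moreover have "antisym r" "trans r"
    using assms by (auto simp: linear_order_on_def partial_order_on_def preorder_on_def)
  \<comment> \<open>Here transitivity would place y at or above the peak t, so y = t, and
    antisymmetry would then give x = y.\<close>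
  moreover have "\<not> ((y, x) \<in> r \<and> (x, t) \<in> r)"
    using calculation xy by (metis antisymD transD lies_between_def)
  ultimately show "prefers s x y"
    using xy unfolding s lies_between_def prefers_def by blast
qed (fact assms)

text \<open>Of three alternatives, the one in the middle of the axis is the worst one for nobody.\<close>
lemma not_single_peaked_rank_orders:
  assumes "finite X" and T: "{u, v, w} \<subseteq> X" "distinct [u, v, w]"
    and last: "\<And>y. y \<in> {u, v, w} \<Longrightarrow> \<exists>g\<in>G. \<forall>x\<in>{u, v, w}. x \<noteq> y \<longrightarrow> g x < g y"
    and P: "set P = rank_order X ` G"
  shows "\<not> single_peaked X P"
proof
  assume "single_peaked X P"
  then obtain ax where ax: "linear_order_on X ax"
    and "\<forall>r\<in>rank_order X ` G. \<forall>t. most_preferred X r t \<longrightarrow>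
      (\<forall>x\<in>X. \<forall>y\<in>X. x \<noteq> y \<and> lies_between ax t x y \<longrightarrow> prefers r x y)"
    unfolding single_peaked_def P by (elim exE conjE)
  then have sp: "prefers (rank_order X g) x y"
    if "g \<in> G" "most_preferred X (rank_order X g) t" "x \<in> X" "y \<in> X" "x \<noteq> y"
      "lies_between ax t x y" for g t x y
    using that by simp
  have total: "(x, y) \<in> ax \<or> (y, x) \<in> ax" if "x \<in> X" "y \<in> X" for x y
    using ax that by (cases "x = y")
      (auto simp: linear_order_on_def partial_order_on_def preorder_on_def total_on_def refl_on_def)
  \<comment> \<open>Totality alone yields such a chain: every tournament on three vertices has a
    Hamiltonian path, and the cases list the six possible paths.\<close>
  obtain x y z where xyz: "{x, y, z} = {u, v, w}" "x \<noteq> y" "z \<noteq> y" "(x, y) \<in> ax" "(y, z) \<in> ax"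
  proof -
    have "u \<in> X" "v \<in> X" "w \<in> X"
      using T by auto
    then consider "(u, v) \<in> ax" "(v, w) \<in> ax"
      | "(u, w) \<in> ax" "(w, v) \<in> ax"
      | "(v, u) \<in> ax" "(u, w) \<in> ax"
      | "(v, w) \<in> ax" "(w, u) \<in> ax"
      | "(w, u) \<in> ax" "(u, v) \<in> ax"
      | "(w, v) \<in> ax" "(v, u) \<in> ax"
      using total by blast
    then show ?thesis
    proof cases
      case 1
      then show ?thesis
        using T(2) by (intro that[of u v w]) auto
    next
      case 2
      then show ?thesis
        using T(2) by (intro that[of u w v]) auto
    next
      case 3
      then show ?thesis
        using T(2) by (intro that[of v u w]) auto
    next
      case 4
      then show ?thesis
        using T(2) by (intro that[of v w u]) auto
    next
      case 5
      then show ?thesis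
        using T(2) by (intro that[of w u v]) auto
    next
      case 6
      then show ?thesis
        using T(2) by (intro that[of w v u]) auto
    qed
  qed
  have "x \<in> X" "y \<in> X" "z \<in> X"
    using xyz(1) T(1) by auto
  obtain g where g: "g \<in> G" "g x < g y" "g z < g y"
    using last[of y] xyz by blast
  obtain t where t: "most_preferred X (rank_order X g) t"
    using ex_most_preferred_rank_order[of X g] assms(1) \<open>x \<in> X\<close> by blast
  then have "t \<in> X"
    by (simp add: most_preferred_def)
  \<comment> \<open>The peak \<open>t\<close> may lie outside the triple. On either side of y, y
    lies between \<open>t\<close> and one of x and z, so it would have to be preferred to that one,
    although \<open>g\<close> ranks y last.\<close>
  from total[OF \<open>t \<in> X\<close> \<open>y \<in> X\<close>] show False
  proof
    assume "(t, y) \<in> ax"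
    with xyz have "lies_between ax t y z"
      by (simp add: lies_between_def)
    with sp[OF g(1) t \<open>y \<in> X\<close> \<open>z \<in> X\<close>] xyz g show False
      by (auto simp: prefers_rank_order)
  next
    assume "(y, t) \<in> ax"
    with xyz have "lies_between ax t y x"
      by (simp add: lies_between_def)
    with sp[OF g(1) t \<open>y \<in> X\<close> \<open>x \<in> X\<close>] xyz g show False
      by (auto simp: prefers_rank_order)
  qed
qed

text \<open>On at most two alternatives every order is compatible with every axis, so all
  \<open>fact k\<close> orders can occur together. Contrapositively, content below 1 forces at least
  three alternatives.\<close>

lemma con_single_peaked_ge_1:
  assumes "k \<le> 2"
  shows "con_single_peaked k \<ge> 1"
proof (cases "k = 0")
  case False
  define M where "M = {card (set P) |P. is_profile {..<k} P \<and> single_peaked {..<k} P}"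
  \<comment> \<open>Finiteness is what makes \<open>Max M\<close> an upper bound of
    \<open>M\<close>; orders are subsets of a finite square.\<close>
  have "M \<subseteq> {..card (Pow ({..<k} \<times> {..<k}))}"
  proof
    fix c assume "c \<in> M"
    then obtain P where "c = card (set P)" "is_profile {..<k} P"
      by (auto simp: M_def)
    moreover have "r \<subseteq> {..<k} \<times> {..<k}" if "linear_order_on {..<k} r" for r :: "(nat \<times> nat) set"
      using that by (auto simp: linear_order_on_def partial_order_on_def preorder_on_def)
    ultimately show "c \<in> {..card (Pow ({..<k} \<times> {..<k}))}"
      by (auto simp: is_profile_def intro!: card_mono)
  qed
  then have "finite M"
    using finite_subset by blast
  \<comment> \<open>The increasing and the decreasing order exhaust the orders for k = 2 and
    coincide for k = 1.\<close>
  define r where "r = rank_order {..<k} int"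
  define s where "s = rank_order {..<k} (\<lambda>x. - int x)"
  have rs: "linear_order_on {..<k} r" "linear_order_on {..<k} s"
    unfolding r_def s_def by (auto intro!: linear_order_rank_order inj_onI)
  have "card (set [r, s]) \<in> M"
    unfolding M_def single_peaked_def
  proof (intro CollectI exI[of _ "[r, s]"] conjI exI[of _ r] ballI allI impI)
    show "is_profile {..<k} [r, s]"
      using rs by (simp add: is_profile_def)
  next
    fix q t x y
    assume "q \<in> set [r, s]" "most_preferred {..<k} q t" "x \<in> {..<k}" "y \<in> {..<k}"
      and xy: "x \<noteq> y \<and> lies_between r t x y"
    moreover from this have "t < 2" "x < 2" "y < 2"
      using assms by (auto simp: most_preferred_def)
    moreover have "t \<noteq> y"
      using xy by (auto simp: lies_between_def r_def rank_order_def)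
    ultimately have "t = x"
      by linarith
    then show "prefers q x y"
      using \<open>most_preferred {..<k} q t\<close> \<open>y \<in> {..<k}\<close> xy by (auto simp: most_preferred_def)
  qed (use rs in auto)
  then have "card (set [r, s]) \<le> Max M"
    using \<open>finite M\<close> by simp
  moreover have "card (set [r, s]) = fact k"
  proof (cases "k = 1")
    case True
    then have "r = s"
      by (auto simp: r_def s_def rank_order_def)
    with True show ?thesis by simp
  next
    case 2: False
    with False assms have "k = 2" by simp
    then have "(0, 1) \<in> r" "(0, 1) \<notin> s"
      by (auto simp: r_def s_def rank_order_def)
    with \<open>k = 2\<close> show ?thesis
      by (auto simp: card_insert_if)
  qed
  ultimately have "real (fact k) \<le> real (Max M)"
    by (metis of_nat_le_iff)
  then show ?thesis
    using False by (simp add: con_single_peaked_def M_def[symmetric] divide_simps)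
qed (simp add: con_single_peaked_def)

subsection \<open>The hard instances\<close>

text \<open>The map f is meant to number the alternatives below m, so agents beyond m match no
  special case and keep the increasing order.\<close>

definition hard_rank :: "nat \<Rightarrow> ('a \<Rightarrow> nat) \<Rightarrow> nat \<Rightarrow> 'a \<Rightarrow> int" where
  "hard_rank m f i x = (if i = m then - int (f x) else if f x = i then - 1 else int (f x))"

definition hard_profile :: "'a set \<Rightarrow> ('a \<Rightarrow> nat) \<Rightarrow> nat \<Rightarrow> 'a preference list" where
  "hard_profile A f n = map (\<lambda>i. rank_order A (hard_rank (card A) f i)) [0..<n]"

lemma length_hard_profile: "length (hard_profile A f n) = n"
  by (simp add: hard_profile_def)

lemma nth_hard_profile:
  "i < n \<Longrightarrow> hard_profile A f n ! i = rank_order A (hard_rank (card A) f i)"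
  by (simp add: hard_profile_def)

lemma is_profile_hard_profile:
  assumes "inj_on f A"
  shows "is_profile A (hard_profile A f n)"
  using inj_onD[OF assms]
  by (auto simp: is_profile_def hard_profile_def hard_rank_def intro!: linear_order_rank_order inj_onI
      split: if_splits)

text \<open>Every agent other than the reversing one and the two promoting x or y gives both their
  original ranks. The bound 3 is the \<open>b\<close> of \<open>tester_error_ge\<close>.\<close>

lemma card_hard_profile_prefers_neq:
  "card {i. i < n \<and> prefers (hard_profile A f n ! i) x y
     \<noteq> prefers (rank_order A (\<lambda>x. int (f x))) x y} \<le> 3"
proof -
  have "card {i. i < n \<and> prefers (hard_profile A f n ! i) x y
     \<noteq> prefers (rank_order A (\<lambda>x. int (f x))) x y} \<le> card {card A, f x, f y}"
    by (intro card_mono)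
      (auto simp: nth_hard_profile prefers_rank_order hard_rank_def split: if_splits)
  also have "\<dots> \<le> 3"
    by (simp add: card_insert_if)
  finally show ?thesis .
qed

text \<open>Only agents 0 to m can deviate, so for large n they are at most half of all
  agents.\<close>

lemma card_hard_profile_neq:
  assumes "f ` A \<subseteq> {..<card A}"
  shows "card {i. i < n \<and> hard_profile A f n ! i \<noteq> rank_order A (\<lambda>x. int (f x))} \<le> Suc (card A)"
proof -
  have "{i. i < n \<and> hard_profile A f n ! i \<noteq> rank_order A (\<lambda>x. int (f x))} \<subseteq> {..card A}"
  proof
    fix i
    assume "i \<in> {i. i < n \<and> hard_profile A f n ! i \<noteq> rank_order A (\<lambda>x. int (f x))}"
    then have "i < n" and neq: "hard_profile A f n ! i \<noteq> rank_order A (\<lambda>x. int (f x))"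
      by auto
    show "i \<in> {..card A}"
    proof (rule ccontr)
      assume "i \<notin> {..card A}"
      then have "hard_profile A f n ! i = rank_order A (\<lambda>x. int (f x))"
        unfolding nth_hard_profile[OF \<open>i < n\<close>]
        using assms by (intro rank_order_cong) (auto simp: hard_rank_def)
      with neq show False ..
    qed
  qed
  from card_mono[OF _ this] show ?thesis by simp
qed

lemma hard_profile_far:
  assumes A: "finite A" and f: "inj_on f A" "f ` A \<subseteq> {..<card A}" and "card A < n"
    and \<epsilon>: "2 \<le> (1 - \<epsilon>) * real (card A)"
  shows "far_input A n \<epsilon> (hard_profile A f n)"
  unfolding far_input_def
proof (intro conjI allI impI)
  fix X assume X: "X \<subseteq> A" "(1 - \<epsilon>) * real (card A) < real (card X)"
  then have "3 \<le> card (f ` X)"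
    using \<epsilon> f(1) inj_on_subset by (subst card_image) auto
  then obtain F where F: "F \<subseteq> f ` X" "card F = 3"
    by (meson obtain_subset_with_card_n)
  obtain a b c where abc: "{a, b, c} \<subseteq> f ` X" "a < b" "b < c"
  proof -
    obtain x y z where "F = {x, y, z}" "x \<noteq> y" "y \<noteq> z" "x \<noteq> z"
      using F(2) by (auto simp: card_3_iff)
    with F(1) show ?thesis
      using that[of x y z] that[of x z y] that[of y x z] that[of y z x] that[of z x y] that[of z y x]
      by (auto simp: insert_commute) (metis linorder_neqE_nat)+
  qed
  then obtain u v w where uvw: "{u, v, w} \<subseteq> X" "f u < f v" "f v < f w"
    by auto
  \<comment> \<open>This keeps the agents \<open>f u\<close> and \<open>f w\<close> apart from the
    reversing agent \<open>card A\<close>.\<close>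
  have "f w < card A"
    using uvw(1) X(1) f(2) by auto
  have "finite X"
    using X(1) A finite_subset by blast
  let ?G = "hard_rank (card A) f ` {..<n}"
  show "\<not> single_peaked X (restrict_profile (hard_profile A f n) X)"
  proof (rule not_single_peaked_rank_orders[OF \<open>finite X\<close> uvw(1), where G = ?G])
    show "\<exists>g\<in>?G. \<forall>x\<in>{u, v, w}. x \<noteq> y \<longrightarrow> g x < g y" if y: "y \<in> {u, v, w}" for y
    proof -
      consider "y = u" | "y = v" | "y = w"
        using y by blast
      \<comment> \<open>To make y worst, reverse the order for u, promote w for v, and promote u for
        w.\<close>
      then obtain i where "i \<le> card A"
        and "\<forall>x\<in>{u, v, w}. x \<noteq> y \<longrightarrow> hard_rank (card A) f i x < hard_rank (card A) f i y"
      proof cases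
        case 1
        with uvw show ?thesis
          by (intro that[of "card A"]) (auto simp: hard_rank_def)
      next
        case 2
        with uvw \<open>f w < card A\<close> show ?thesis
          by (intro that[of "f w"]) (auto simp: hard_rank_def)
      next
        case 3
        with uvw \<open>f w < card A\<close> show ?thesis
          by (intro that[of "f u"]) (auto simp: hard_rank_def)
      qed
      then show ?thesis
        using \<open>card A < n\<close> by (intro bexI[of _ "hard_rank (card A) f i"]) auto
    qed
    show "set (restrict_profile (hard_profile A f n) X) = rank_order X ` ?G"
      by (auto simp: restrict_profile_def hard_profile_def Restr_rank_order[OF X(1)] image_image
          simp flip: atLeast0LessThan)
  qed (use uvw in auto)
qed (use f in \<open>auto simp: length_hard_profile is_profile_hard_profile\<close>)

text \<open>The ratio of ln ((1 - \<delta>) / \<delta>) to ln (1 / \<delta>) is 1 - ln (1 -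
  \<delta>) / ln \<delta>, which decreases in \<delta>. Its value at \<open>\<delta>0\<close> is
  therefore a uniform constant, positive because \<open>\<delta>0 < 1/2\<close>.\<close>

lemma ln_odds_ge:
  fixes \<delta>0 \<delta> :: real
  assumes "0 < \<delta>" "\<delta> \<le> \<delta>0" "\<delta>0 < 1/2"
  shows "0 < 1 - ln (1 - \<delta>0) / ln \<delta>0"
    and "(1 - ln (1 - \<delta>0) / ln \<delta>0) * ln (1 / \<delta>) \<le> ln ((1 - \<delta>) / \<delta>)"
proof -
  have neg: "ln \<delta>0 < ln (1 - \<delta>0)" "ln (1 - \<delta>0) < 0" "ln \<delta>0 < 0"
    using assms by auto
  then show "0 < 1 - ln (1 - \<delta>0) / ln \<delta>0"
    by (simp add: divide_simps)
  have "ln (1 - \<delta>0) / ln \<delta>0 * ln \<delta> \<le> ln (1 - \<delta>0) / ln \<delta>0 * ln \<delta>0"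
    using assms neg by (intro mult_left_mono) (auto simp: divide_nonpos_nonpos)
  also have "\<dots> \<le> ln (1 - \<delta>)"
    using assms neg by simp
  finally show "(1 - ln (1 - \<delta>0) / ln \<delta>0) * ln (1 / \<delta>) \<le> ln ((1 - \<delta>) / \<delta>)"
    using assms by (simp add: ln_div algebra_simps)
qed

section \<open>Assembling the lower bound\<close>

lemma sample_complexity_ge:
  assumes "single_peaked_input A n P \<or> far_input A n \<epsilon> P" "(a, q) \<in> set_pmf (run T P [])"
  shows "ereal (real q) \<le> sample_complexity A n \<epsilon> T"
  unfolding sample_complexity_def using assms
  by (intro SUP_upper2[of P] SUP_upper2[of "(a, q)"]) auto

theorem theorem3p13:
  fixes \<delta>0 :: real
  assumes "\<delta>0 < 1/2"
  shows "\<exists>c>0. \<forall>m::nat. \<exists>n0::nat. \<forall>n\<ge>n0.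
           \<forall>(A :: 'a set) (\<epsilon> :: real) (\<delta> :: real) (T :: 'a algorithm).
             finite A \<longrightarrow> card A = m \<longrightarrow> 0 < \<epsilon> \<longrightarrow> \<epsilon> \<le> 1 \<longrightarrow> 0 < \<delta> \<longrightarrow> \<delta> \<le> \<delta>0 \<longrightarrow>
             con_single_peaked (nat \<lceil>(1 - \<epsilon>) * real m\<rceil>) < 1 \<longrightarrow>
             is_tester A n \<epsilon> \<delta> T \<longrightarrow>
             ereal (c * real n * ln (1 / \<delta>)) \<le> sample_complexity A n \<epsilon> T"
proof (cases "0 < \<delta>0")
  case False
  \<comment> \<open>No \<delta> is admissible when \<open>\<delta>0\<close> is not positive.\<close>
  then show ?thesis
    by (intro exI[of _ 1]) auto
next
  case True
  \<comment> \<open>The 12 is 4 * b with b = 3, from the exponent in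
    \<open>tester_error_ge\<close>.\<close>
  define c where "c = (1 - ln (1 - \<delta>0) / ln \<delta>0) / 12"
  have "c > 0"
    using ln_odds_ge(1)[OF True order_refl assms] by (simp add: c_def)
  \<comment> \<open>The threshold \<open>2 * card A + 12\<close> makes the at most
    \<open>card A + 1\<close> deviating agents a minority and gives 4 * 3 \<le> n.\<close>
  moreover have "ereal (c * real n * ln (1 / \<delta>)) \<le> sample_complexity A n \<epsilon> T"
    if n: "2 * card A + 12 \<le> n" and A: "finite A" and \<delta>: "0 < \<delta>" "\<delta> \<le> \<delta>0"
      and con: "con_single_peaked (nat \<lceil>(1 - \<epsilon>) * real (card A)\<rceil>) < 1"
      and T: "is_tester A n \<epsilon> \<delta> T"
    for n and A :: "'a set" and \<epsilon> \<delta> and T :: "'a algorithm"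
  proof -
    have "\<not> nat \<lceil>(1 - \<epsilon>) * real (card A)\<rceil> \<le> 2"
      using con con_single_peaked_ge_1 by fastforce
    then have \<epsilon>: "2 \<le> (1 - \<epsilon>) * real (card A)"
      by linarith
    obtain f where f: "inj_on f A" "f ` A \<subseteq> {..<card A}"
      using ex_bij_betw_finite_nat[OF A] by (auto simp: bij_betw_def lessThan_atLeast0)
    define r where "r = rank_order A (\<lambda>x. int (f x))"
    define P where "P = hard_profile A f n"
    have [simp]: "length P = n"
      by (simp add: P_def length_hard_profile)
    have "P \<noteq> []"
      using n \<open>length P = n\<close> by (cases P) simp_all
    have r: "linear_order_on A r"
      using f(1) unfolding r_def by (intro linear_order_rank_order) (auto simp: inj_on_def)
    then have sp: "single_peaked_input A n (replicate n r)"
      by (simp add: single_peaked_input_def is_profile_def single_peaked_replicate)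
    have far: "far_input A n \<epsilon> P"
      unfolding P_def using n by (intro hard_profile_far A f \<epsilon>) auto
    show ?thesis
    proof (cases "sample_complexity A n \<epsilon> T")
      case (real Q)
      have "(1 - \<delta>) * exp (- (4 * real 3 / real (length P)) * Q) \<le> \<delta>"
      proof (rule tester_error_ge[where T = T and r = r])
        show "card {i. i < length P \<and> prefers (P ! i) x y \<noteq> prefers r x y} \<le> 3" for x y
          unfolding P_def r_def length_hard_profile by (rule card_hard_profile_prefers_neq)
        show "2 * card {i. i < length P \<and> P ! i \<noteq> r} \<le> length P"
          using card_hard_profile_neq[OF f(2), of n] n by (simp add: P_def r_def length_hard_profile)
        show "real q \<le> Q" if "(a, q) \<in> set_pmf (run T (replicate (length P) r) [])" for a q
          using sample_complexity_ge[of A n "replicate n r" \<epsilon> a q T] sp that real by simp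
      qed (use n T sp far \<open>P \<noteq> []\<close> in \<open>auto simp: is_tester_def\<close>)
      then have "(1 - \<delta>) / \<delta> \<le> exp (12 / real n * Q)"
        using \<delta> by (simp add: exp_minus field_simps)
      then have "ln ((1 - \<delta>) / \<delta>) \<le> 12 / real n * Q"
        using \<delta> assms ln_le_cancel_iff[of "(1 - \<delta>) / \<delta>" "exp (12 / real n * Q)"] by simp
      moreover have "12 * c = 1 - ln (1 - \<delta>0) / ln \<delta>0"
        by (simp add: c_def)
      ultimately have "12 * c * ln (1 / \<delta>) \<le> 12 / real n * Q"
        using ln_odds_ge(2)[OF \<delta> assms] by simp
      then show ?thesis
        using n by (simp add: real field_simps)
    next
      \<comment> \<open>Impossible: some run on an admissible input exists, and its query count is a
        natural number.\<close>
      case MInf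
      moreover obtain x where "x \<in> set_pmf (run T (replicate n r) [])"
        using set_pmf_not_empty by fast
      ultimately show ?thesis
        using sample_complexity_ge[of A n "replicate n r" \<epsilon> "fst x" "snd x" T] sp by simp
    qed simp
  qed
  ultimately show ?thesis
    by (intro exI[of _ c] conjI allI exI[of _ "2 * m + 12" for m] impI) auto
qed

end
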